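(* Let $S\subset\mathbb{N}^p$ be an affine semigroup whose cone $\mathcal{C}_S$ has extremal rays $\tau_1,\ldots,\tau_t$, minimally generated by $E\sqcup A$ with $E=\{n_1,\ldots,n_t\}$, $n_i=\mathrm{mult}_i(S)$ for $i\in\{1,\ldots,t\}$, and $A=\{n_{t+1},\ldots,n_r\}$. Then $S$ is a MED-semigroup if and only if the $I(S)$-semigroup $(E+S)\cup\{0\}$ is equal to $S\setminus A$.
   Context: $\mathbb{N}$ contains $0$, and $p\ge 1$. An affine semigroup $S\subseteq\mathbb{N}^p$ is a finitely generated submonoid of $(\mathbb{N}^p,+)$ (containing $0$). $\mathcal{C}_S$ is the set of non-negative rational linear combinations of elements of $S$, intersected with $\mathbb{N}^p$; its extremal rays are the one-dimensional faces of the rational cone generated by $S$ (intersected with $\mathbb{N}^p$). The $i$-multiplicity $\mathrm{mult}_i(S)$ is the minimum non-zero element of $\tau_i\cap S$ for the componentwise partial order on $\mathbb{N}^p$. An affine semigroup $T$ is an $I(S)$-semigroup if $T\setminus\{0\}$ is an ideal of $S$, i.e. $T\setminus\{0\}\subseteq S$ and $(T\setminus\{0\})+S\subseteq T\setminus\{0\}$. The Apery set of $S$ with respect to $m\in S$ is $\mathrm{Ap}(S,m)=\{s\in S\mid s-m\notin S\}$. With $S$ minimally generated by $E\sqcup A$ as in the claim, $S$ is a maximal embedding dimension affine semigroup (MED-semigroup) if $\bigcap_{i=1}^t\mathrm{Ap}(S,n_i)=A\sqcup\{0\}$. *)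

theory Defs
  imports "HOL-Analysis.Cartesian_Space" "HOL-Library.Set_Algebras"
begin

definition submonoid_set :: "(nat ^ 'p) set \<Rightarrow> bool" where
  "submonoid_set M \<longleftrightarrow> 0 \<in> M \<and> (\<forall>x\<in>M. \<forall>y\<in>M. x + y \<in> M)"

definition affine_semigroup :: "(nat ^ 'p) set \<Rightarrow> bool" where
  "affine_semigroup S \<longleftrightarrow> (\<exists>G. finite G \<and> S = submonoid_set hull G)"

definition minimal_generating_set :: "(nat ^ 'p) set \<Rightarrow> (nat ^ 'p) set \<Rightarrow> bool" where
  "minimal_generating_set G S \<longleftrightarrow>
     submonoid_set hull G = S \<and> (\<forall>H. H \<subset> G \<longrightarrow> submonoid_set hull H \<noteq> S)"

definition to_rat :: "nat ^ 'p \<Rightarrow> rat ^ 'p" where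
  "to_rat x = (\<chi> i. of_nat (x $ i))"

definition rat_cone :: "(nat ^ 'p) set \<Rightarrow> (rat ^ 'p) set" where
  "rat_cone S = {\<Sum>s\<in>F. c s *s to_rat s | F c. finite F \<and> F \<subseteq> S \<and> (\<forall>s\<in>F. 0 \<le> c s)}"

text \<open>The library's notion of a face is only available over the reals; this is the usual
  notion of a face of a convex cone, over the rationals.\<close>

definition cone_face :: "(rat ^ 'p) set \<Rightarrow> (rat ^ 'p) set \<Rightarrow> bool" where
  "cone_face F C \<longleftrightarrow>
     F \<subseteq> C \<and> 0 \<in> F \<and> (\<forall>x\<in>F. \<forall>y\<in>F. x + y \<in> F) \<and> (\<forall>x\<in>F. \<forall>c\<ge>0. c *s x \<in> F) \<and>
     (\<forall>x\<in>C. \<forall>y\<in>C. x + y \<in> F \<longrightarrow> x \<in> F \<and> y \<in> F)"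

definition extremal_rays :: "(nat ^ 'p) set \<Rightarrow> (nat ^ 'p) set set" where
  "extremal_rays S = {to_rat -` F | F. cone_face F (rat_cone S) \<and> vec.dim F = 1}"

text \<open>The order on vectors is componentwise, so the least element is a minimum for this
  partial order.\<close>

definition ray_mult :: "(nat ^ 'p) set \<Rightarrow> (nat ^ 'p) set \<Rightarrow> nat ^ 'p" where
  "ray_mult S \<tau> = (LEAST m. m \<in> \<tau> \<inter> S \<and> m \<noteq> 0)"

definition I_semigroup :: "(nat ^ 'p) set \<Rightarrow> (nat ^ 'p) set \<Rightarrow> bool" where
  "I_semigroup S T \<longleftrightarrow>
     affine_semigroup T \<and> T - {0} \<subseteq> S \<and> (T - {0}) + S \<subseteq> T - {0}"

text \<open>Subtraction of vectors of naturals is truncated componentwise; the guard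
  \<open>m \<le> s\<close> makes the membership of \<open>s - m\<close> that of the integer difference.\<close>

definition apery :: "(nat ^ 'p) set \<Rightarrow> nat ^ 'p \<Rightarrow> (nat ^ 'p) set" where
  "apery S m = {s \<in> S. \<not> (m \<le> s \<and> s - m \<in> S)}"

text \<open>Here \<open>E\<close> is the set of multiplicities of \<open>S\<close> and \<open>A\<close> the set of the remaining minimal
  generators. The intersection is taken inside \<open>S\<close>, which only matters when \<open>E\<close> is empty,
  that is, for \<open>S = {0}\<close>.\<close>

definition MED_semigroup ::
  "(nat ^ 'p) set \<Rightarrow> (nat ^ 'p) set \<Rightarrow> (nat ^ 'p) set \<Rightarrow> bool" where
  "MED_semigroup S E A \<longleftrightarrow> S \<inter> (\<Inter>m\<in>E. apery S m) = A \<union> {0}"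

end

theory Submission
  imports Defs
begin

text \<open>Since the intersection of the Apery sets is \<open>S - (E + S)\<close>, the equivalence is set theory. The
  content lies in the finite generation of \<open>(E + S) \<union> {0}\<close>, which holds because every generator \<open>g\<close>
  of \<open>S\<close> has a multiple in \<open>E + S\<close>: the generators in the face of \<open>g\<close>, scaled to coordinate sum 1,
  have an element of maximal Euclidean norm, which by strict convexity spans an extremal ray, and
  the multiplicity of that ray is again in the face of \<open>g\<close>.\<close>

subsection \<open>Submonoids and their generators\<close>

lemma submonoid_hull: "submonoid_set (submonoid_set hull G)"
  unfolding hull_def submonoid_set_def by blast

lemma smult_Suc_vec: "Suc k *s x = x + k *s (x :: nat ^ 'p)"
  by (simp add: vec_eq_iff)

lemma submonoid_smult: "submonoid_set M \<Longrightarrow> x \<in> M \<Longrightarrow> k *s x \<in> M"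
proof (induction k)
  case 0
  then show ?case by (simp add: submonoid_set_def)
next
  case (Suc k)
  then show ?case unfolding smult_Suc_vec by (simp add: submonoid_set_def)
qed

lemma submonoid_sum: "submonoid_set M \<Longrightarrow> (\<And>i. i \<in> I \<Longrightarrow> f i \<in> M) \<Longrightarrow> sum f I \<in> M"
  by (induction I rule: infinite_finite_induct) (auto simp: submonoid_set_def)

lemma submonoid_hull_sum:
  assumes "I \<subseteq> G"
  shows "(\<Sum>g\<in>I. c g *s g) \<in> submonoid_set hull G"
proof (rule submonoid_sum)
  show "c g *s g \<in> submonoid_set hull G" if "g \<in> I" for g
    using hull_inc[of g G] assms that by (metis submonoid_hull submonoid_smult subsetD)
qed (rule submonoid_hull)

text \<open>The natural combinations already form a submonoid containing \<open>G\<close>. This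
  explicit form is what allows induction on coefficients later.\<close>

lemma submonoid_hull_finite:
  assumes "finite G"
  shows "submonoid_set hull G = range (\<lambda>c. \<Sum>g\<in>G. c g *s g)"
proof
  let ?R = "range (\<lambda>c. \<Sum>g\<in>G. c g *s g)"
  have "x + y \<in> ?R" if "x \<in> ?R" "y \<in> ?R" for x y
  proof -
    from that obtain c d where "x = (\<Sum>g\<in>G. c g *s g)" "y = (\<Sum>g\<in>G. d g *s g)" by auto
    then have "x + y = (\<Sum>g\<in>G. (c g + d g) *s g)"
      by (simp add: sum.distrib vector_sadd_rdistrib)
    then show ?thesis by (rule range_eqI[where x = "\<lambda>g. c g + d g"])
  qed
  moreover have "0 \<in> ?R" by (rule range_eqI[where x = "\<lambda>_. 0"]) simp
  ultimately have "submonoid_set ?R"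
    unfolding submonoid_set_def by blast
  moreover have "g \<in> ?R" if "g \<in> G" for g
  proof (rule range_eqI)
    have "(\<Sum>h\<in>G. (if h = g then 1 else 0) *s h) = (\<Sum>h\<in>G. if h = g then h else 0)"
      by (rule sum.cong) (auto simp: vec_eq_iff)
    then show "g = (\<Sum>h\<in>G. (if h = g then 1 else 0) *s h)" using assms that by simp
  qed
  ultimately show "submonoid_set hull G \<subseteq> ?R"
    by (intro hull_minimal) blast+
  show "range (\<lambda>c. \<Sum>g\<in>G. c g *s g) \<subseteq> submonoid_set hull G"
    by (auto intro: submonoid_hull_sum)
qed

text \<open>Every submonoid contains 0, so deleting it from \<open>G\<close> leaves the hull
  unchanged. Nonzero generators can be scaled to coordinate sum 1, and they keep 0 out of
  \<open>E + S\<close>.\<close>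

lemma zero_notin_minimal_generating_set:
  assumes "minimal_generating_set G S"
  shows "0 \<notin> G"
proof
  assume "0 \<in> G"
  have "G \<subseteq> submonoid_set hull (G - {0})"
    using hull_subset[of "G - {0}" submonoid_set] submonoid_hull[of "G - {0}"]
    by (auto simp: submonoid_set_def)
  then have "submonoid_set hull G \<subseteq> submonoid_set hull (G - {0})"
    by (rule hull_minimal) (rule submonoid_hull)
  moreover have "submonoid_set hull (G - {0}) \<subseteq> submonoid_set hull G"
    by (rule hull_mono) auto
  ultimately show False
    using assms \<open>0 \<in> G\<close> unfolding minimal_generating_set_def by blast
qed

text \<open>Division with remainder on the coefficients leaves finitely many remainders. The
  assumption \<open>multiple\<close> carries the weight: in the plane with \<open>E\<close>
  consisting of (1,0) alone, it fails for (0,1), and all the elements (1,n) would be needed as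
  generators.\<close>

lemma affine_semigroup_ideal:
  fixes S E G :: "(nat ^ 'p) set"
  assumes G: "finite G" "submonoid_set hull G = S" and E: "finite E" "E \<subseteq> S"
    and multiple: "\<And>g. g \<in> G \<Longrightarrow> \<exists>k>0. k *s g \<in> E + S"
  shows "affine_semigroup ((E + S) \<union> {0})"
proof -
  have S: "submonoid_set S" using G submonoid_hull by blast
  obtain k where k: "\<And>g. g \<in> G \<Longrightarrow> k g > 0" "\<And>g. g \<in> G \<Longrightarrow> k g *s g \<in> E + S"
    using multiple by metis
  \<comment> \<open>A coefficient of \<open>g\<close> that is at least \<open>k g\<close> can be reduced by splitting off the generator \<open>k g *s g\<close>.\<close>
  define R where "R = (\<lambda>c. \<Sum>g\<in>G. c g *s g) ` (\<Pi>\<^sub>E g\<in>G. {..<k g})"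
  define B where "B = (\<lambda>g. k g *s g) ` G \<union> (E + R)"
  have "finite R" unfolding R_def using G(1) by (intro finite_imageI finite_PiE) auto
  then have "finite B" unfolding B_def using G(1) E(1) by (simp add: finite_set_plus)
  have "submonoid_set ((E + S) \<union> {0})"
    unfolding submonoid_set_def
  proof (intro conjI ballI)
    fix x y assume x: "x \<in> (E + S) \<union> {0}" and y: "y \<in> (E + S) \<union> {0}"
    have "x + y \<in> E + S" if "x \<in> E + S" "y \<in> E + S"
    proof -
      from that obtain e s e' s' where *: "e \<in> E" "s \<in> S" "e' \<in> E" "s' \<in> S" "x = e + s" "y = e' + s'"
        by (auto elim!: set_plus_elim)
      then have "s + (e' + s') \<in> S" using S E(2) by (auto simp: submonoid_set_def)
      then show ?thesis using * by (metis add.assoc set_plus_intro)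
    qed
    then show "x + y \<in> (E + S) \<union> {0}" using x y by auto
  qed auto
  moreover have "R \<subseteq> S" unfolding R_def using submonoid_hull_finite[OF G(1)] G(2) by auto
  then have "B \<subseteq> (E + S) \<union> {0}" unfolding B_def using k(2) by (auto elim!: set_plus_elim)
  ultimately have 1: "submonoid_set hull B \<subseteq> (E + S) \<union> {0}" by (metis hull_minimal)
  \<comment> \<open>Induction on the total of the coefficients, which drops with each block
    \<open>k h *s h\<close> split off because \<open>k h > 0\<close>; the summand \<open>e\<close>
    stays until the remainder is in \<open>R\<close>.\<close>
  have *: "e + (\<Sum>g\<in>G. c g *s g) \<in> submonoid_set hull B" if "e \<in> E" for e c
  proof (induction "\<Sum>g\<in>G. c g" arbitrary: c rule: less_induct)
    case less
    show ?case
    proof (cases "\<forall>g\<in>G. c g < k g")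
      case True
      \<comment> \<open>\<open>R\<close> is built from extensional functions, so \<open>c\<close> is
        first made undefined off \<open>G\<close>.\<close>
      have "(\<Sum>g\<in>G. c g *s g) = (\<Sum>g\<in>G. restrict c G g *s g)" by (rule sum.cong) auto
      also have "\<dots> \<in> R" unfolding R_def using True by (intro imageI) auto
      finally have "e + (\<Sum>g\<in>G. c g *s g) \<in> B" unfolding B_def using that by auto
      then show ?thesis by (rule hull_inc)
    next
      case False
      then obtain h where h: "h \<in> G" "k h \<le> c h" by (auto simp: not_less)
      define d where "d = c(h := c h - k h)"
      have "(\<Sum>g\<in>G. d g) < (\<Sum>g\<in>G. c g)"
        using h k(1)[OF h(1)] G(1) by (intro sum_strict_mono_ex1) (auto simp: d_def)
      then have "e + (\<Sum>g\<in>G. d g *s g) \<in> submonoid_set hull B" by (rule less)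
      moreover have "k h *s h \<in> submonoid_set hull B"
        using h(1) by (intro hull_inc) (auto simp: B_def)
      moreover have "(\<Sum>g\<in>G. c g *s g) = (\<Sum>g\<in>G. d g *s g) + k h *s h"
      proof -
        have "(\<Sum>g\<in>G - {h}. c g *s g) = (\<Sum>g\<in>G - {h}. d g *s g)"
          by (rule sum.cong) (auto simp: d_def)
        moreover have "c h *s h = d h *s h + k h *s h"
          using h(2) by (simp add: d_def flip: vector_sadd_rdistrib)
        ultimately show ?thesis
          unfolding sum.remove[OF G(1) h(1)] by (simp add: ac_simps)
      qed
      ultimately show ?thesis
        using submonoid_hull[of B] by (simp add: submonoid_set_def flip: add.assoc)
    qed
  qed
  have "E + S \<subseteq> submonoid_set hull B"
    using * unfolding G(2)[symmetric] submonoid_hull_finite[OF G(1)] by (auto elim!: set_plus_elim)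
  then have "(E + S) \<union> {0} = submonoid_set hull B"
    using 1 submonoid_hull[of B] by (auto simp: submonoid_set_def)
  then show ?thesis unfolding affine_semigroup_def using \<open>finite B\<close> by blast
qed

subsection \<open>The rational cone\<close>

lemma to_rat_nth [simp]: "to_rat x $ i = of_nat (x $ i)"
  by (simp add: to_rat_def)

lemma to_rat_eq_iff: "to_rat x = to_rat y \<longleftrightarrow> x = y"
  by (simp add: vec_eq_iff)

lemma to_rat_eq_0_iff [simp]: "to_rat x = 0 \<longleftrightarrow> x = 0"
  by (simp add: vec_eq_iff)

lemma to_rat_smult: "to_rat (k *s x) = of_nat k *s to_rat x"
  by (simp add: vec_eq_iff)

lemma to_rat_sum: "to_rat (sum f I) = (\<Sum>i\<in>I. to_rat (f i))"
  by (simp add: vec_eq_iff)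

text \<open>Expanding each element of \<open>S\<close> over \<open>G\<close> and swapping the sums
  gives all cone elements coefficients on one finite index set, so that those of two elements can be
  added.\<close>

lemma rat_cone_generators:
  assumes "finite G" "x \<in> rat_cone (submonoid_set hull G)"
  obtains a where "\<And>g. g \<in> G \<Longrightarrow> 0 \<le> a g" "x = (\<Sum>g\<in>G. a g *s to_rat g)"
proof -
  obtain F c where F: "finite F" "F \<subseteq> submonoid_set hull G" "\<And>s. s \<in> F \<Longrightarrow> 0 \<le> c s"
    and x: "x = (\<Sum>s\<in>F. c s *s to_rat s)"
    using assms(2) unfolding rat_cone_def by auto
  have "\<exists>d. s = (\<Sum>g\<in>G. d g *s g)" if "s \<in> F" for s
    using F(2) that submonoid_hull_finite[OF assms(1)] by auto
  then obtain d where d: "\<And>s. s \<in> F \<Longrightarrow> s = (\<Sum>g\<in>G. d s g *s g)" by metis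
  have "c s *s to_rat s = (\<Sum>g\<in>G. (c s * of_nat (d s g)) *s to_rat g)" if "s \<in> F" for s
    by (subst d[OF that])
      (simp add: to_rat_sum to_rat_smult vec.scale_sum_right vector_smult_assoc)
  then have "x = (\<Sum>s\<in>F. \<Sum>g\<in>G. (c s * of_nat (d s g)) *s to_rat g)" by (simp add: x)
  also have "\<dots> = (\<Sum>g\<in>G. \<Sum>s\<in>F. (c s * of_nat (d s g)) *s to_rat g)" by (rule sum.swap)
  also have "\<dots> = (\<Sum>g\<in>G. (\<Sum>s\<in>F. c s * of_nat (d s g)) *s to_rat g)"
    by (simp add: vec.scale_sum_left)
  finally show thesis
    using F(3) by (intro that[of "\<lambda>g. \<Sum>s\<in>F. c s * of_nat (d s g)"]) (auto intro!: sum_nonneg)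
qed

text \<open>Nonnegativity makes the numerators natural numbers, so that rational relations become
  relations inside the monoid.\<close>

lemma common_denominator:
  fixes a :: "'i \<Rightarrow> rat"
  assumes "finite I" "\<And>i. i \<in> I \<Longrightarrow> 0 \<le> a i"
  shows "\<exists>N>0. \<exists>m. \<forall>i\<in>I. of_nat N * a i = of_nat (m i)"
  using assms
proof (induction I rule: finite_induct)
  case empty
  then show ?case by auto
next
  case (insert j I)
  then obtain N m where N: "N > 0" "\<And>i. i \<in> I \<Longrightarrow> of_nat N * a i = of_nat (m i)" by auto
  obtain p q :: int where pq: "a j = of_int p / of_int q" "q > 0"
    by (metis quotient_of_div quotient_of_denom_pos surj_pair)
  have "p \<ge> 0" using insert.prems[of j] pq by (simp add: zero_le_divide_iff)
  \<comment> \<open>The new denominator is \<open>N * nat q\<close>: old numerators gain the factor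
    \<open>q\<close>, while at \<open>j\<close> the \<open>q\<close> cancels and leaves
    \<open>N * nat p\<close>.\<close>
  define m' where "m' i = (if i = j then N * nat p else nat q * m i)" for i
  have "of_nat (N * nat q) * a i = of_nat (m' i)" if "i \<in> insert j I" for i
  proof (cases "i = j")
    case True
    then show ?thesis using pq \<open>p \<ge> 0\<close> by (simp add: m'_def)
  next
    case False
    then show ?thesis using N(2)[of i] that by (simp add: m'_def)
  qed
  moreover have "N * nat q > 0" using N(1) pq(2) by simp
  ultimately show ?case by blast
qed

text \<open>\<open>h\<close> lies in the smallest face of the cone of \<open>S\<close> containing \<open>g\<close>, stated without the cone.\<close>

definition in_face :: "(nat ^ 'p) set \<Rightarrow> nat ^ 'p \<Rightarrow> nat ^ 'p \<Rightarrow> bool" where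
  "in_face S g h \<longleftrightarrow> (\<exists>k. \<exists>s\<in>S. k *s g = h + s)"

lemma in_face_trans:
  assumes "submonoid_set S" "in_face S f g" "in_face S g h"
  shows "in_face S f h"
proof -
  obtain k s l u where *: "s \<in> S" "k *s f = g + s" "u \<in> S" "l *s g = h + u"
    using assms unfolding in_face_def by auto
  have "(l * k) *s f = l *s (k *s f)" by (simp add: vector_smult_assoc)
  also have "\<dots> = h + (u + l *s s)" using * by (simp add: vector_add_ldistrib add.assoc)
  finally show ?thesis
    unfolding in_face_def using * assms(1) submonoid_smult[OF assms(1) *(1)]
    by (metis submonoid_set_def)
qed

text \<open>Clearing denominators turns the relation into one over the naturals. The coefficient of
  \<open>h\<close> stays positive, so one copy of \<open>h\<close> can be split off and the rest
  remains in the monoid.\<close>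

lemma in_face_rat_combination:
  assumes "finite G" and "\<And>g. g \<in> G \<Longrightarrow> 0 \<le> b g" and "0 \<le> c"
    and eq: "(\<Sum>g\<in>G. b g *s to_rat g) = c *s to_rat v"
    and h: "h \<in> G" "b h > 0"
  shows "in_face (submonoid_set hull G) v h"
proof -
  \<comment> \<open>\<open>None\<close> indexes the coefficient of \<open>v\<close>, so that a
    single denominator serves both sides of \<open>eq\<close>.\<close>
  let ?a = "\<lambda>x. case x of None \<Rightarrow> c | Some g \<Rightarrow> b g"
  have "\<exists>N>0. \<exists>m. \<forall>i\<in>insert None (Some ` G). of_nat N * ?a i = of_nat (m i)"
    using assms by (intro common_denominator) auto
  then obtain N m where N: "N > 0" "\<And>i. i \<in> insert None (Some ` G) \<Longrightarrow> of_nat N * ?a i = of_nat (m i)"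
    by blast
  define d where "d g = m (Some g)" for g
  have d: "of_nat N * b g = of_nat (d g)" if "g \<in> G" for g
    using N(2)[of "Some g"] that by (simp add: d_def)
  have c: "of_nat N * c = of_nat (m None)" using N(2)[of None] by simp
  have "d h > 0" using d[OF h(1)] h(2) N(1) by (metis mult_pos_pos of_nat_0_less_iff)
  have "to_rat (m None *s v) = of_nat N *s (c *s to_rat v)"
    by (simp add: to_rat_smult vector_smult_assoc c)
  also have "\<dots> = to_rat (\<Sum>g\<in>G. d g *s g)"
    by (simp add: to_rat_sum to_rat_smult vec.scale_sum_right vector_smult_assoc d flip: eq)
  finally have "m None *s v = (\<Sum>g\<in>G. d g *s g)" by (simp add: to_rat_eq_iff)
  also have "\<dots> = Suc (d h - 1) *s h + (\<Sum>g\<in>G - {h}. d g *s g)"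
    using assms(1) h(1) \<open>d h > 0\<close> by (simp add: sum.remove)
  also have "\<dots> = h + ((d h - 1) *s h + (\<Sum>g\<in>G - {h}. d g *s g))"
    unfolding smult_Suc_vec by (simp add: add.assoc)
  finally have "m None *s v = h + ((d h - 1) *s h + (\<Sum>g\<in>G - {h}. d g *s g))" .
  moreover have "(d h - 1) *s h + (\<Sum>g\<in>G - {h}. d g *s g) \<in> submonoid_set hull G"
  proof -
    have "(d h - 1) *s h \<in> submonoid_set hull G"
      using submonoid_hull_sum[of "{h}" G "\<lambda>_. d h - 1"] h(1) by simp
    moreover have "(\<Sum>g\<in>G - {h}. d g *s g) \<in> submonoid_set hull G"
      by (rule submonoid_hull_sum) auto
    ultimately show ?thesis using submonoid_hull[of G] by (simp add: submonoid_set_def)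
  qed
  ultimately show ?thesis unfolding in_face_def by blast
qed

subsection \<open>Extremal rays\<close>

text \<open>Strict convexity of the Euclidean norm: the weighted sum of the squared distances from
  \<open>f i\<close> to \<open>v\<close> equals the weighted sum of the differences of squared
  norms, which is at most 0. Squared norms keep everything rational.\<close>

lemma max_norm_vertex:
  fixes f :: "'i \<Rightarrow> rat ^ 'p" and v :: "rat ^ 'p"
  assumes "finite I" and b: "\<And>i. i \<in> I \<Longrightarrow> 0 \<le> b i"
    and f: "\<And>i. i \<in> I \<Longrightarrow> (\<Sum>j\<in>UNIV. f i $ j) = 1" and v: "(\<Sum>j\<in>UNIV. v $ j) = 1"
    and max: "\<And>i. i \<in> I \<Longrightarrow> b i > 0 \<Longrightarrow> (\<Sum>j\<in>UNIV. (f i $ j)\<^sup>2) \<le> (\<Sum>j\<in>UNIV. (v $ j)\<^sup>2)"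
    and eq: "(\<Sum>i\<in>I. b i *s f i) = c *s v"
    and i: "i \<in> I" "b i > 0"
  shows "f i = v"
proof -
  have nth: "(\<Sum>i\<in>I. b i * f i $ j) = c * v $ j" for j
    using arg_cong[OF eq, of "\<lambda>x. x $ j"] by simp
  \<comment> \<open>Adding up the coordinates of \<open>eq\<close> identifies \<open>c\<close> as
    the total weight, since all vectors have coordinate sum 1.\<close>
  have "c = (\<Sum>j\<in>UNIV. c * v $ j)" by (simp add: v flip: sum_distrib_left)
  also have "\<dots> = (\<Sum>j\<in>UNIV. \<Sum>i\<in>I. b i * f i $ j)" by (simp add: nth)
  also have "\<dots> = (\<Sum>i\<in>I. \<Sum>j\<in>UNIV. b i * f i $ j)" by (rule sum.swap)
  also have "\<dots> = (\<Sum>i\<in>I. b i)" by (simp add: f flip: sum_distrib_left)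
  finally have c: "c = (\<Sum>i\<in>I. b i)" .
  let ?q = "\<lambda>x :: rat ^ 'p. \<Sum>j\<in>UNIV. (x $ j)\<^sup>2"
  \<comment> \<open>This is the inner product of \<open>eq\<close> with \<open>v\<close>; it
    evaluates the mixed term of the expanded squares.\<close>
  have cross: "(\<Sum>i\<in>I. b i * (\<Sum>j\<in>UNIV. f i $ j * v $ j)) = c * ?q v"
  proof -
    have "(\<Sum>i\<in>I. b i * (\<Sum>j\<in>UNIV. f i $ j * v $ j)) = (\<Sum>i\<in>I. \<Sum>j\<in>UNIV. b i * f i $ j * v $ j)"
      by (simp add: sum_distrib_left mult.assoc)
    also have "\<dots> = (\<Sum>j\<in>UNIV. \<Sum>i\<in>I. b i * f i $ j * v $ j)" by (rule sum.swap)
    also have "\<dots> = (\<Sum>j\<in>UNIV. c * v $ j * v $ j)"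
      by (simp add: nth flip: sum_distrib_right)
    finally show ?thesis by (simp add: sum_distrib_left power2_eq_square mult.assoc)
  qed
  have sq: "?q (f i - v) = ?q (f i) - 2 * (\<Sum>j\<in>UNIV. f i $ j * v $ j) + ?q v" for i
    by (simp add: power2_diff sum.distrib sum_subtractf sum_distrib_left algebra_simps)
  have "(\<Sum>i\<in>I. b i * ?q (f i - v)) =
      (\<Sum>i\<in>I. b i * ?q (f i)) - 2 * (\<Sum>i\<in>I. b i * (\<Sum>j\<in>UNIV. f i $ j * v $ j)) + (\<Sum>i\<in>I. b i) * ?q v"
    unfolding sq
    by (simp add: algebra_simps sum.distrib sum_subtractf sum_distrib_right[of b] sum_distrib_left[of 2 _ I])
  also have "\<dots> = (\<Sum>i\<in>I. b i * ?q (f i)) - (\<Sum>i\<in>I. b i * ?q v)"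
    by (simp add: cross flip: c sum_distrib_right)
  also have "\<dots> \<le> 0"
  proof -
    have "b i * ?q (f i) \<le> b i * ?q v" if "i \<in> I" for i
      using b[OF that] max[OF that] by (cases "b i = 0") (auto intro: mult_left_mono)
    then show ?thesis by (simp add: sum_mono)
  qed
  finally have "(\<Sum>i\<in>I. b i * ?q (f i - v)) \<le> 0" .
  moreover have nonneg: "0 \<le> b i * ?q (f i - v)" if "i \<in> I" for i
    using b[OF that] by (intro mult_nonneg_nonneg sum_nonneg) auto
  ultimately have "(\<Sum>i\<in>I. b i * ?q (f i - v)) = 0"
    by (meson antisym sum_nonneg)
  then have "b i * ?q (f i - v) = 0"
    using nonneg i(1) assms(1) by (simp add: sum_nonneg_eq_0_iff)
  then have "?q (f i - v) = 0" using i(2) by simp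
  then show "f i = v" by (simp add: sum_nonneg_eq_0_iff vec_eq_iff)
qed

definition coord_sum :: "nat ^ 'p \<Rightarrow> nat" where
  "coord_sum x = (\<Sum>i\<in>UNIV. x $ i)"

lemma coord_sum_pos: "x \<noteq> 0 \<Longrightarrow> 0 < coord_sum x"
  by (auto simp: coord_sum_def vec_eq_iff sum_pos2)

text \<open>Radial projection to the hyperplane of coordinate sum 1, where nonzero vectors of the
  same ray coincide. At 0 the value is 0, as \<open>inverse 0 = 0\<close>.\<close>

definition normalised :: "nat ^ 'p \<Rightarrow> rat ^ 'p" where
  "normalised x = inverse (of_nat (coord_sum x)) *s to_rat x"

lemma smult_normalised: "x \<noteq> 0 \<Longrightarrow> of_nat (coord_sum x) *s normalised x = to_rat x"
  using coord_sum_pos[of x] by (simp add: normalised_def vector_smult_assoc)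

lemma sum_normalised:
  assumes "x \<noteq> 0"
  shows "(\<Sum>j\<in>UNIV. normalised x $ j) = 1"
proof -
  have "(\<Sum>j\<in>UNIV. normalised x $ j) = inverse (of_nat (coord_sum x)) * of_nat (coord_sum x)"
    by (simp add: normalised_def coord_sum_def sum_distrib_left)
  then show ?thesis using coord_sum_pos[OF assms] by simp
qed

definition rat_ray :: "nat ^ 'p \<Rightarrow> (rat ^ 'p) set" where
  "rat_ray v = {c *s to_rat v | c. 0 \<le> c}"

lemma to_rat_in_rat_ray: "to_rat v \<in> rat_ray v"
  unfolding rat_ray_def by (auto intro!: exI[of _ 1])

lemma dim_rat_ray:
  assumes "v \<noteq> 0"
  shows "vec.dim (rat_ray v) = 1"
proof (rule vec.dim_unique)
  show "{to_rat v} \<subseteq> rat_ray v" by (simp add: to_rat_in_rat_ray)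
  show "rat_ray v \<subseteq> vec.span {to_rat v}"
    by (auto simp: rat_ray_def intro: vec.span_scale vec.span_base)
  show "vec.independent {to_rat v}" using assms by simp
qed simp

text \<open>If \<open>x + y\<close> is on the ray, each generator occurring in it lies in the face
  of \<open>v\<close>, so \<open>max\<close> bounds its norm and \<open>max_norm_vertex\<close> puts
  it on the ray of \<open>v\<close>. Then \<open>x\<close> and \<open>y\<close> are on the ray as
  well.\<close>

lemma cone_face_rat_ray:
  assumes G: "finite G" "0 \<notin> G" and S: "S = submonoid_set hull G" and v: "v \<in> G"
    and max: "\<And>h. h \<in> G \<Longrightarrow> in_face S v h \<Longrightarrow>
      (\<Sum>j\<in>UNIV. (normalised h $ j)\<^sup>2) \<le> (\<Sum>j\<in>UNIV. (normalised v $ j)\<^sup>2)"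
  shows "cone_face (rat_ray v) (rat_cone S)"
proof -
  have v0: "v \<noteq> 0" using G v by auto
  \<comment> \<open>Here \<open>b\<close> stands for the coefficients of \<open>x + y\<close> and
    \<open>a\<close> for those of either summand, hence \<open>a g \<le> b g\<close>; one fact
    serves both summands.\<close>
  have ray: "(\<Sum>g\<in>G. a g *s to_rat g) \<in> rat_ray v"
    if a: "\<And>g. g \<in> G \<Longrightarrow> 0 \<le> a g"
      and b: "\<And>g. g \<in> G \<Longrightarrow> a g \<le> b g" and eq: "(\<Sum>g\<in>G. b g *s to_rat g) = c *s to_rat v" and c: "0 \<le> c"
    for a b c
  proof -
    have *: "normalised g = normalised v" if g: "g \<in> G" "b g > 0" for g
    \<comment> \<open>Replacing \<open>to_rat g\<close> by \<open>normalised g\<close> multiplies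
      its coefficient by \<open>coord_sum g\<close>; likewise for \<open>v\<close>.\<close>
    proof (rule max_norm_vertex[where I = G and b = "\<lambda>g. b g * of_nat (coord_sum g)"
          and c = "c * of_nat (coord_sum v)"])
      show "0 \<le> b g * of_nat (coord_sum g)" if "g \<in> G" for g
        using a[OF that] b[OF that] by simp
      show "(\<Sum>j\<in>UNIV. normalised g $ j) = 1" if "g \<in> G" for g
        using that G by (intro sum_normalised) auto
      show "(\<Sum>j\<in>UNIV. (normalised g $ j)\<^sup>2) \<le> (\<Sum>j\<in>UNIV. (normalised v $ j)\<^sup>2)"
        if "g \<in> G" "0 < b g * of_nat (coord_sum g)" for g
      proof (rule max[OF that(1)])
        have "b g > 0" using that by (simp add: zero_less_mult_iff)
        then show "in_face S v g"
          unfolding S using G(1) a b c eq that(1)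
          by (intro in_face_rat_combination[where b = b and c = c]) (auto intro: order_trans)
      qed
      have "(\<Sum>g\<in>G. (b g * of_nat (coord_sum g)) *s normalised g) = (\<Sum>g\<in>G. b g *s to_rat g)"
      proof (rule sum.cong)
        fix g assume "g \<in> G"
        then have "g \<noteq> 0" using G(2) by auto
        from smult_normalised[OF this]
        show "(b g * of_nat (coord_sum g)) *s normalised g = b g *s to_rat g"
          by (simp flip: vector_smult_assoc)
      qed simp
      then show "(\<Sum>g\<in>G. (b g * of_nat (coord_sum g)) *s normalised g)
          = (c * of_nat (coord_sum v)) *s normalised v"
        unfolding eq smult_normalised[OF v0, symmetric] by (simp add: vector_smult_assoc)
      show "0 < b g * of_nat (coord_sum g)"
        using g G(2) coord_sum_pos[of g] by (cases "g = 0") auto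
    qed (use G v0 g in \<open>auto intro: sum_normalised\<close>)
    have **: "a g *s to_rat g = (a g * of_nat (coord_sum g) / of_nat (coord_sum v)) *s to_rat v"
      if "g \<in> G" for g
    proof (cases "a g = 0")
      case False
      then have "b g > 0" using a[OF that] b[OF that] by simp
      have "g \<noteq> 0" using that G by auto
      then have "to_rat g = of_nat (coord_sum g) *s normalised v"
        using *[OF that \<open>b g > 0\<close>] smult_normalised by metis
      then show ?thesis
        using v0 by (simp add: normalised_def vector_smult_assoc divide_inverse mult.assoc)
    qed simp
    have "(\<Sum>g\<in>G. a g *s to_rat g) =
        (\<Sum>g\<in>G. a g * of_nat (coord_sum g) / of_nat (coord_sum v)) *s to_rat v"
      using ** by (simp add: vec.scale_sum_left)
    moreover have "0 \<le> (\<Sum>g\<in>G. a g * of_nat (coord_sum g) / of_nat (coord_sum v))"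
      using a by (intro sum_nonneg) auto
    ultimately show ?thesis unfolding rat_ray_def by blast
  qed
  have vS: "v \<in> S" using v S by (simp add: hull_inc)
  have "c *s to_rat v \<in> rat_cone S" if "0 \<le> c" for c
  proof -
    have "c *s to_rat v = (\<Sum>s\<in>{v}. (\<lambda>_. c) s *s to_rat s)
        \<and> finite {v} \<and> {v} \<subseteq> S \<and> (\<forall>s\<in>{v}. 0 \<le> (\<lambda>_. c) s)"
      using vS that by simp
    then show ?thesis unfolding rat_cone_def mem_Collect_eq by (intro exI)
  qed
  then have "rat_ray v \<subseteq> rat_cone S" by (auto simp: rat_ray_def)
  moreover have "0 \<in> rat_ray v" unfolding rat_ray_def by force
  moreover have "x + y \<in> rat_ray v" if "x \<in> rat_ray v" "y \<in> rat_ray v" for x y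
    using that unfolding rat_ray_def by (auto simp flip: vector_sadd_rdistrib)
  moreover have "c *s x \<in> rat_ray v" if "x \<in> rat_ray v" "c \<ge> 0" for x c
    using that unfolding rat_ray_def by (auto simp: vector_smult_assoc)
  moreover have "x \<in> rat_ray v \<and> y \<in> rat_ray v"
    if x: "x \<in> rat_cone S" and y: "y \<in> rat_cone S" and xy: "x + y \<in> rat_ray v" for x y
  proof -
    obtain a where a: "\<And>g. g \<in> G \<Longrightarrow> 0 \<le> a g" "x = (\<Sum>g\<in>G. a g *s to_rat g)"
      using rat_cone_generators[OF G(1)] x S by metis
    obtain b where b: "\<And>g. g \<in> G \<Longrightarrow> 0 \<le> b g" "y = (\<Sum>g\<in>G. b g *s to_rat g)"
      using rat_cone_generators[OF G(1)] y S by metis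
    obtain c where c: "0 \<le> c" "x + y = c *s to_rat v" using xy by (auto simp: rat_ray_def)
    have eq: "(\<Sum>g\<in>G. (a g + b g) *s to_rat g) = c *s to_rat v"
      using c(2) unfolding a(2) b(2) by (simp add: vector_sadd_rdistrib sum.distrib)
    have "x \<in> rat_ray v" unfolding a(2)
      using a(1) b(1) c(1) by (intro ray[OF _ _ eq]) auto
    moreover have "y \<in> rat_ray v" unfolding b(2)
      using a(1) b(1) c(1) by (intro ray[OF _ _ eq]) auto
    ultimately show ?thesis ..
  qed
  ultimately show ?thesis unfolding cone_face_def by blast
qed

text \<open>\<open>v\<close> is a generator of maximal normalised norm among those in the face of
  \<open>g\<close>.\<close>

lemma extremal_ray_in_face:
  assumes G: "finite G" "0 \<notin> G" and S: "S = submonoid_set hull G" and g: "g \<in> G"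
  obtains v where "v \<in> G" "in_face S g v" "to_rat -` rat_ray v \<in> extremal_rays S"
proof -
  have sub: "submonoid_set S" by (simp add: S submonoid_hull)
  let ?q = "\<lambda>h. \<Sum>j\<in>UNIV. (normalised h $ j)\<^sup>2"
  let ?H = "{h \<in> G. in_face S g h}"
  have "1 *s g = g + 0" by (simp only: vector_smult_lid add_0_right)
  then have "in_face S g g"
    unfolding in_face_def using sub by (metis submonoid_set_def)
  then have "finite ?H" "?H \<noteq> {}" using G g by auto
  then have "Max (?q ` ?H) \<in> ?q ` ?H" by (intro Max_in) auto
  then obtain v where v: "v \<in> ?H" and "Max (?q ` ?H) = ?q v" by (rule imageE)
  moreover have "?q h \<le> Max (?q ` ?H)" if "h \<in> ?H" for h
    using \<open>finite ?H\<close> that by (intro Max_ge) auto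
  ultimately have max: "?q h \<le> ?q v" if "h \<in> ?H" for h
    using that by simp
  have "cone_face (rat_ray v) (rat_cone S)"
    \<comment> \<open>By transitivity the face of \<open>v\<close> is inside that of
      \<open>g\<close>, so \<open>v\<close> is also maximal within its own face.\<close>
    using v max in_face_trans[OF sub] by (intro cone_face_rat_ray[OF G S]) auto
  moreover have "vec.dim (rat_ray v) = 1" using v G by (intro dim_rat_ray) auto
  ultimately have "to_rat -` rat_ray v \<in> extremal_rays S" unfolding extremal_rays_def by blast
  then show thesis using that v by blast
qed

text \<open>Elements of one ray are totally ordered by their scalar factor, so the one of least
  coordinate sum is least componentwise. Hence the \<open>LEAST\<close> in \<open>ray_mult\<close>
  is attained, by a positive rational multiple of \<open>v\<close>.\<close>

lemma ray_mult_in_face: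
  assumes S: "submonoid_set S" and v: "v \<in> S" "v \<noteq> 0"
  shows "in_face S v (ray_mult S (to_rat -` rat_ray v))"
proof -
  let ?P = "\<lambda>m. m \<in> (to_rat -` rat_ray v) \<inter> S \<and> m \<noteq> 0"
  have "?P v" using v by (simp add: to_rat_in_rat_ray)
  then obtain m where m: "?P m" and least: "\<And>x. ?P x \<Longrightarrow> coord_sum m \<le> coord_sum x"
    using ex_has_least_nat[of ?P v coord_sum] by blast
  obtain c where c: "0 \<le> c" "to_rat m = c *s to_rat v" using m by (auto simp: rat_ray_def)
  have "c \<noteq> 0" using m c by auto
  have "m \<le> x" if x: "?P x" for x
  proof -
    obtain d where d: "0 \<le> d" "to_rat x = d *s to_rat v" using x by (auto simp: rat_ray_def)
    have nth: "of_nat (m $ i) = c * of_nat (v $ i)" "of_nat (x $ i) = d * of_nat (v $ i)" for i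
      using arg_cong[OF c(2), of "\<lambda>x. x $ i"] arg_cong[OF d(2), of "\<lambda>x. x $ i"] by simp_all
    have "of_nat (coord_sum m) = c * of_nat (coord_sum v)"
      "of_nat (coord_sum x) = d * of_nat (coord_sum v)"
      by (simp_all add: coord_sum_def nth sum_distrib_left)
    then have "c * of_nat (coord_sum v) \<le> d * of_nat (coord_sum v)"
      using least[OF x] by (metis of_nat_le_iff)
    then have "c \<le> d" using coord_sum_pos[OF v(2)] by simp
    then have "(of_nat (m $ i) :: rat) \<le> of_nat (x $ i)" for i
      by (simp add: nth mult_right_mono)
    then show ?thesis by (simp add: less_eq_vec_def)
  qed
  then have "ray_mult S (to_rat -` rat_ray v) = m"
    unfolding ray_mult_def using m by (intro Least_equality) auto
  \<comment> \<open>\<open>m\<close> may fail to be a generator of \<open>S\<close>, so the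
    criterion is applied to the monoid generated by \<open>m\<close> alone, which lies in
    \<open>S\<close>.\<close>
  moreover have "in_face (submonoid_set hull {m}) v m"
    using c by (intro in_face_rat_combination[where b = "\<lambda>_. 1" and c = c]) auto
  moreover have "submonoid_set hull {m} \<subseteq> S" using m S by (intro hull_minimal) auto
  ultimately show ?thesis unfolding in_face_def by auto
qed

subsection \<open>The ideal generated by the multiplicities\<close>

text \<open>An element of \<open>S\<close> misses the Apery set of \<open>m\<close> exactly when it
  is \<open>m\<close> plus an element of \<open>S\<close>. For empty \<open>E\<close> both sides are
  \<open>S\<close>.\<close>

lemma Inter_apery: "S \<inter> (\<Inter>m\<in>E. apery S m) = S - (E + S)"
proof -
  have *: "m \<le> s \<and> s - m \<in> S \<longleftrightarrow> (\<exists>u\<in>S. s = m + u)" for m s :: "nat ^ 'a"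
  proof
    assume "m \<le> s \<and> s - m \<in> S"
    moreover from this have "s = m + (s - m)" by (simp add: vec_eq_iff less_eq_vec_def)
    ultimately show "\<exists>u\<in>S. s = m + u" by blast
  next
    assume "\<exists>u\<in>S. s = m + u"
    then obtain u where u: "u \<in> S" "s = m + u" by blast
    then have "s - m = u" by (simp add: vec_eq_iff)
    then show "m \<le> s \<and> s - m \<in> S" using u by (simp add: less_eq_vec_def)
  qed
  show ?thesis unfolding apery_def * by (auto simp: set_plus_def)
qed

theorem theorem25:
  fixes S E A :: "(nat ^ 'p) set" and \<tau> :: "nat \<Rightarrow> (nat ^ 'p) set"
    and n :: "nat \<Rightarrow> nat ^ 'p" and t r :: nat
  assumes "affine_semigroup S"
    and "bij_betw \<tau> {1..t} (extremal_rays S)"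
    and "t \<le> r"
    and "\<And>i. i \<in> {1..t} \<Longrightarrow> n i = ray_mult S (\<tau> i)"
    and "E = n ` {1..t}"
    and "A = n ` {t+1..r}"
    and "E \<inter> A = {}"
    and "minimal_generating_set (E \<union> A) S"
  shows "I_semigroup S ((E + S) \<union> {0}) \<and>
         (MED_semigroup S E A \<longleftrightarrow> (E + S) \<union> {0} = S - A)"
proof -
  let ?G = "E \<union> A"
  have fin: "finite ?G" and "finite E" using assms(5,6) by auto
  have S: "S = submonoid_set hull ?G"
    using assms(8) by (simp add: minimal_generating_set_def)
  have sub: "submonoid_set S" unfolding S by (rule submonoid_hull)
  have GS: "?G \<subseteq> S" unfolding S by (rule hull_subset)
  have nz: "0 \<notin> ?G" using assms(8) by (rule zero_notin_minimal_generating_set)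
  \<comment> \<open>Two steps down the faces: from \<open>g\<close> to a generator \<open>v\<close>
    on an extremal ray, then to the multiplicity \<open>n i\<close> of that ray.\<close>
  have "\<exists>k>0. k *s g \<in> E + S" if g: "g \<in> ?G" for g
  proof -
    obtain v where v: "v \<in> ?G" "in_face S g v" "to_rat -` rat_ray v \<in> extremal_rays S"
      using extremal_ray_in_face[OF fin nz S g] .
    then obtain i where i: "i \<in> {1..t}" "\<tau> i = to_rat -` rat_ray v"
      using assms(2) by (metis bij_betw_imp_surj_on imageE)
    have "v \<in> S" "v \<noteq> 0" using v(1) GS nz by auto
    then have "in_face S v (n i)" using ray_mult_in_face[OF sub] i assms(4) by simp
    then have "in_face S g (n i)" by (rule in_face_trans[OF sub v(2)])
    then obtain k s where k: "s \<in> S" "k *s g = n i + s" unfolding in_face_def by auto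
    have "n i \<in> E" using i assms(5) by simp
    then have "n i \<noteq> 0" using nz by auto
    \<comment> \<open>For \<open>k = 0\<close> the sum \<open>n i + s\<close> would vanish, forcing
      \<open>n i = 0\<close>.\<close>
    then have "k \<noteq> 0" using k(2) by (intro notI) (auto simp: vec_eq_iff)
    then show ?thesis using k \<open>n i \<in> E\<close> by (metis gr0I set_plus_intro)
  qed
  then have "affine_semigroup ((E + S) \<union> {0})"
    using GS \<open>finite E\<close> fin S by (intro affine_semigroup_ideal[of ?G]) auto
  moreover have ES: "E + S \<subseteq> S"
    using GS sub by (auto simp: submonoid_set_def elim!: set_plus_elim)
  moreover have ES0: "0 \<notin> E + S"
  proof
    assume "0 \<in> E + S"
    then obtain e s where "e \<in> E" "0 = e + s" by (auto elim!: set_plus_elim)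
    moreover from this have "e = 0" by (simp add: vec_eq_iff)
    ultimately show False using nz by auto
  qed
  moreover have "(E + S) + S \<subseteq> E + S"
  proof -
    have "S + S \<subseteq> S" using sub by (auto simp: submonoid_set_def elim!: set_plus_elim)
    then have "E + (S + S) \<subseteq> E + S" by (intro set_plus_mono2) auto
    then show ?thesis by (simp add: add.assoc)
  qed
  ultimately have "I_semigroup S ((E + S) \<union> {0})"
    unfolding I_semigroup_def by auto
  moreover have "MED_semigroup S E A \<longleftrightarrow> (E + S) \<union> {0} = S - A"
    \<comment> \<open>Both sides say that \<open>E + S\<close>, \<open>A\<close> and the singleton
      of 0 partition \<open>S\<close>: 0 lies in \<open>S\<close> but neither in
      \<open>E + S\<close> nor in \<open>A\<close>.\<close>
    unfolding MED_semigroup_def Inter_apery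
    using ES ES0 GS nz sub unfolding submonoid_set_def by blast
  ultimately show ?thesis ..
qed

end
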